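(* Let $n\ge2$. The algebraic two-sided ideal in $\mathfrak{L}_n$ generated by $L_2$, namely $\left\{\sum_{i=1}^pB_iL_2C_i : p\ge1,\ B_i,C_i\in\mathfrak{L}_n\right\}$, is not norm closed.
   Context: Let $\mathcal{F}_n$ be the unital free semigroup on $n$ generators $z_1,\dots,z_n$ (its unit is the empty word $1$), and let $\mathcal{H}_n=\ell_2(\mathcal{F}_n)$, with orthonormal basis $\{\xi_w: w\in\mathcal{F}_n\}$. Let $L_i$ be the isometry on $\mathcal{H}_n$ with $L_i\xi_v=\xi_{z_iv}$. The non-commutative analytic Toeplitz algebra $\mathfrak{L}_n$ is the unital algebra, closed in the weak operator topology, generated by $L_1,\dots,L_n$ in $\mathcal{B}(\mathcal{H}_n)$. *)

theory Defs
  imports "HOL-Analysis.Analysis"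
begin

section \<open>The complex Hilbert space of square-summable functions\<close>

typedef 'a ell2 = "{f :: 'a \<Rightarrow> complex. (\<lambda>w. (cmod (f w))\<^sup>2) summable_on UNIV}"
  by (rule exI[of _ "\<lambda>_. 0"]) simp

setup_lifting type_definition_ell2

lemma ell2_prod_abs_summable:
  fixes f g :: "'a \<Rightarrow> complex"
  assumes "(\<lambda>w. (cmod (f w))\<^sup>2) summable_on UNIV" "(\<lambda>w. (cmod (g w))\<^sup>2) summable_on UNIV"
  shows "(\<lambda>w. cmod (f w * cnj (g w))) summable_on UNIV"
proof (rule summable_on_comparison_test)
  show "(\<lambda>w. (cmod (f w))\<^sup>2 + (cmod (g w))\<^sup>2) summable_on UNIV"
    using assms by (rule summable_on_add)
  fix w
  have "2 * (cmod (f w) * cmod (g w)) \<le> (cmod (f w))\<^sup>2 + (cmod (g w))\<^sup>2"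
    using sum_squares_bound[of "cmod (f w)" "cmod (g w)"] by simp
  moreover have "0 \<le> cmod (f w) * cmod (g w)" by simp
  ultimately show "cmod (f w * cnj (g w)) \<le> (cmod (f w))\<^sup>2 + (cmod (g w))\<^sup>2"
    unfolding norm_mult complex_mod_cnj by linarith
qed auto

lemma ell2_prod_summable:
  fixes f g :: "'a \<Rightarrow> complex"
  assumes "(\<lambda>w. (cmod (f w))\<^sup>2) summable_on UNIV" "(\<lambda>w. (cmod (g w))\<^sup>2) summable_on UNIV"
  shows "(\<lambda>w. f w * cnj (g w)) summable_on UNIV"
  by (rule abs_summable_summable, rule ell2_prod_abs_summable[OF assms])

lemma ell2_add_summable:
  fixes f g :: "'a \<Rightarrow> complex"
  assumes "(\<lambda>w. (cmod (f w))\<^sup>2) summable_on UNIV" "(\<lambda>w. (cmod (g w))\<^sup>2) summable_on UNIV"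
  shows "(\<lambda>w. (cmod (f w + g w))\<^sup>2) summable_on UNIV"
proof (rule summable_on_comparison_test)
  show "(\<lambda>w. 2 * (cmod (f w))\<^sup>2 + 2 * (cmod (g w))\<^sup>2) summable_on UNIV"
    using assms by (intro summable_on_add summable_on_cmult_right)
  fix w
  have "(cmod (f w + g w))\<^sup>2 \<le> (cmod (f w) + cmod (g w))\<^sup>2"
    by (intro power_mono norm_triangle_ineq) auto
  also have "\<dots> \<le> 2 * (cmod (f w))\<^sup>2 + 2 * (cmod (g w))\<^sup>2"
    using sum_squares_bound[of "cmod (f w)" "cmod (g w)"]
    by (simp add: power2_sum)
  finally show "(cmod (f w + g w))\<^sup>2 \<le> 2 * (cmod (f w))\<^sup>2 + 2 * (cmod (g w))\<^sup>2" .
qed auto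

lemma ell2_scale_summable:
  fixes f :: "'a \<Rightarrow> complex"
  assumes "(\<lambda>w. (cmod (f w))\<^sup>2) summable_on UNIV"
  shows "(\<lambda>w. (cmod (c * f w))\<^sup>2) summable_on UNIV"
  using summable_on_cmult_right[OF assms, of "(cmod c)\<^sup>2"]
  by (simp add: norm_mult power_mult_distrib)

lift_definition scaleC_ell2 :: "complex \<Rightarrow> 'a ell2 \<Rightarrow> 'a ell2" is "\<lambda>c f w. c * f w"
  by (simp add: ell2_scale_summable)

text \<open>The complex inner product, linear in the first argument.\<close>

lift_definition cinner_ell2 :: "'a ell2 \<Rightarrow> 'a ell2 \<Rightarrow> complex"
  is "\<lambda>f g. \<Sum>\<^sub>\<infinity>w. f w * cnj (g w)" .

instantiation ell2 :: (type) real_vector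
begin
lift_definition zero_ell2 :: "'a ell2" is "\<lambda>_. 0" by simp
lift_definition plus_ell2 :: "'a ell2 \<Rightarrow> 'a ell2 \<Rightarrow> 'a ell2" is "\<lambda>f g w. f w + g w"
  by (simp add: ell2_add_summable)
lift_definition uminus_ell2 :: "'a ell2 \<Rightarrow> 'a ell2" is "\<lambda>f w. - f w" by simp
lift_definition minus_ell2 :: "'a ell2 \<Rightarrow> 'a ell2 \<Rightarrow> 'a ell2" is "\<lambda>f g w. f w - g w"
  subgoal for f g using ell2_add_summable[of f "\<lambda>w. - g w"] by simp
  done
definition scaleR_ell2 :: "real \<Rightarrow> 'a ell2 \<Rightarrow> 'a ell2" where
  "scaleR_ell2 r = scaleC_ell2 (complex_of_real r)"
instance
  by standard (unfold scaleR_ell2_def, (transfer, simp add: algebra_simps)+)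
end

instantiation ell2 :: (type) real_inner
begin
definition inner_ell2 :: "'a ell2 \<Rightarrow> 'a ell2 \<Rightarrow> real" where
  "inner_ell2 f g = Re (cinner_ell2 f g)"
lift_definition norm_ell2 :: "'a ell2 \<Rightarrow> real" is "\<lambda>f. sqrt (\<Sum>\<^sub>\<infinity>w. (cmod (f w))\<^sup>2)" .
definition dist_ell2 :: "'a ell2 \<Rightarrow> 'a ell2 \<Rightarrow> real" where
  "dist_ell2 f g = norm (f - g)"
definition sgn_ell2 :: "'a ell2 \<Rightarrow> 'a ell2" where
  "sgn_ell2 f = f /\<^sub>R norm f"
definition uniformity_ell2 :: "('a ell2 \<times> 'a ell2) filter" where
  "uniformity_ell2 = (INF e\<in>{0<..}. principal {(x, y). dist x y < e})"
definition open_ell2 :: "'a ell2 set \<Rightarrow> bool" where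
  "open_ell2 U \<longleftrightarrow> (\<forall>x\<in>U. eventually (\<lambda>(x', y). x' = x \<longrightarrow> y \<in> U) uniformity)"
instance
proof
  fix x y z :: "'a ell2" and r :: real
  show "dist x y = norm (x - y)" by (rule dist_ell2_def)
  show "sgn x = x /\<^sub>R norm x" by (rule sgn_ell2_def)
  show "uniformity = (INF e\<in>{0<..}. principal {(x :: 'a ell2, y). dist x y < e})"
    by (rule uniformity_ell2_def)
  show "open U = (\<forall>x\<in>U. \<forall>\<^sub>F (x', y) in uniformity. x' = x \<longrightarrow> y \<in> U)" for U :: "'a ell2 set"
    by (rule open_ell2_def)
  have self: "cinner_ell2 x x = complex_of_real ((norm x)\<^sup>2)" for x :: "'a ell2"
  proof transfer
    fix f :: "'a \<Rightarrow> complex"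
    assume s: "(\<lambda>w. (cmod (f w))\<^sup>2) summable_on UNIV"
    have "(\<Sum>\<^sub>\<infinity>w. f w * cnj (f w)) = (\<Sum>\<^sub>\<infinity>w. complex_of_real ((cmod (f w))\<^sup>2))"
      by (simp only: complex_norm_square)
    also have "\<dots> = complex_of_real (\<Sum>\<^sub>\<infinity>w. (cmod (f w))\<^sup>2)"
      by (rule infsumI[OF has_sum_of_real[OF has_sum_infsum[OF s]]])
    finally show "(\<Sum>\<^sub>\<infinity>w. f w * cnj (f w)) =
        complex_of_real ((sqrt (\<Sum>\<^sub>\<infinity>w. (cmod (f w))\<^sup>2))\<^sup>2)"
      by (simp add: infsum_nonneg)
  qed
  have nn: "norm x \<ge> 0" for x :: "'a ell2"
    by transfer (simp add: infsum_nonneg)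
  show "inner x y = inner y x"
  proof -
    have "cinner_ell2 x y = cnj (cinner_ell2 y x)"
    proof transfer
      fix f g :: "'a \<Rightarrow> complex"
      have "(\<Sum>\<^sub>\<infinity>w. f w * cnj (g w)) = (\<Sum>\<^sub>\<infinity>w. cnj (g w * cnj (f w)))"
        by (simp only: complex_cnj_mult complex_cnj_cnj mult.commute)
      then show "(\<Sum>\<^sub>\<infinity>w. f w * cnj (g w)) = cnj (\<Sum>\<^sub>\<infinity>w. g w * cnj (f w))"
        by (simp only: infsum_cnj)
    qed
    then show ?thesis by (metis inner_ell2_def cnj.sel(1))
  qed
  show "inner (x + y) z = inner x z + inner y z"
  proof -
    have "cinner_ell2 (x + y) z = cinner_ell2 x z + cinner_ell2 y z"
    proof (transfer, clarsimp)
      fix x y z :: "'a \<Rightarrow> complex"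
      assume "(\<lambda>w. (cmod (x w))\<^sup>2) summable_on UNIV" "(\<lambda>w. (cmod (y w))\<^sup>2) summable_on UNIV"
        "(\<lambda>w. (cmod (z w))\<^sup>2) summable_on UNIV"
      then show "(\<Sum>\<^sub>\<infinity>w. (x w + y w) * cnj (z w)) =
          (\<Sum>\<^sub>\<infinity>w. x w * cnj (z w)) + (\<Sum>\<^sub>\<infinity>w. y w * cnj (z w))"
        unfolding distrib_right
        by (intro infsum_add ell2_prod_summable)
    qed
    then show ?thesis by (simp add: inner_ell2_def)
  qed
  show "inner (r *\<^sub>R x) y = r * inner x y"
  proof -
    have "cinner_ell2 (r *\<^sub>R x) y = complex_of_real r * cinner_ell2 x y"
      unfolding scaleR_ell2_def by transfer (simp add: mult.assoc infsum_cmult_right')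
    then show ?thesis by (simp add: inner_ell2_def)
  qed
  show "0 \<le> inner x x" by (simp add: inner_ell2_def self)
  show "norm x = sqrt (inner x x)" by (simp add: inner_ell2_def self nn)
  show "inner x x = 0 \<longleftrightarrow> x = 0"
  proof -
    have "norm x = 0 \<longleftrightarrow> x = 0"
    proof (transfer, clarsimp)
      fix x :: "'a \<Rightarrow> complex"
      assume s: "(\<lambda>w. (cmod (x w))\<^sup>2) summable_on UNIV"
      show "(\<Sum>\<^sub>\<infinity>w. (cmod (x w))\<^sup>2) = 0 \<longleftrightarrow> x = (\<lambda>_. 0)"
      proof
        assume "(\<Sum>\<^sub>\<infinity>w. (cmod (x w))\<^sup>2) = 0"
        then have "(cmod (x w))\<^sup>2 = 0" for w
          using nonneg_infsum_le_0D[of "\<lambda>w. (cmod (x w))\<^sup>2" UNIV w] s by simp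
        then show "x = (\<lambda>_. 0)" by auto
      qed simp
    qed
    then show ?thesis by (simp add: inner_ell2_def self)
  qed
qed
end

lemma norm_scaleC_ell2: "norm (scaleC_ell2 c x) = cmod c * norm x"
  by transfer (simp add: norm_mult power_mult_distrib infsum_cmult_right' real_sqrt_mult)

lemma bounded_linear_scaleC_ell2: "bounded_linear (scaleC_ell2 c)"
proof (rule bounded_linear_intro)
  show "scaleC_ell2 c (x + y) = scaleC_ell2 c x + scaleC_ell2 c y" for x y :: "'a ell2"
    by transfer (simp add: algebra_simps)
  show "scaleC_ell2 c (r *\<^sub>R x) = r *\<^sub>R scaleC_ell2 c x" for r and x :: "'a ell2"
    unfolding scaleR_ell2_def by transfer (simp add: algebra_simps)
  show "norm (scaleC_ell2 c x) \<le> norm x * cmod c" for x :: "'a ell2"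
    by (simp add: norm_scaleC_ell2)
qed

section \<open>Bounded operators\<close>

text \<open>Elements of the library type of bounded linear maps are only real-linear, so
  the algebra of bounded operators on the complex Hilbert space is the (norm-closed)
  subset of the complex-linear ones. The norm is the operator norm in either case.\<close>

definition bounded_ops :: "('a ell2 \<Rightarrow>\<^sub>L 'a ell2) set" where
  "bounded_ops = {T :: 'a ell2 \<Rightarrow>\<^sub>L 'a ell2. \<forall>c x. T (scaleC_ell2 c x) = scaleC_ell2 c (T x)}"

definition scaleC_op :: "complex \<Rightarrow> ('a ell2 \<Rightarrow>\<^sub>L 'a ell2) \<Rightarrow> ('a ell2 \<Rightarrow>\<^sub>L 'a ell2)" where
  "scaleC_op c T = Blinfun (\<lambda>x. scaleC_ell2 c (T x))"

lemma scaleC_op_apply: "scaleC_op c T x = scaleC_ell2 c (T x)"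
  using bounded_linear_Blinfun_apply[OF bounded_linear_compose[OF
      bounded_linear_scaleC_ell2 blinfun.bounded_linear_right[of T]], of c]
  by (simp add: scaleC_op_def)

text \<open>The coarsest topology on \<^term>\<open>bounded_ops\<close> making all matrix coefficients
  \<open>T \<mapsto> \<langle>T x, y\<rangle>\<close> continuous; \<^term>\<open>euclidean\<close> is here the product topology on functions.\<close>

definition weak_operator_topology :: "('a ell2 \<Rightarrow>\<^sub>L 'a ell2) topology" where
  "weak_operator_topology =
     pullback_topology bounded_ops (\<lambda>T (x, y). cinner_ell2 (blinfun_apply T x) y) euclidean"

lemma topspace_weak_operator_topology: "topspace weak_operator_topology = bounded_ops"
  by (simp add: weak_operator_topology_def topspace_pullback_topology)

definition unital_subalgebra :: "('a ell2 \<Rightarrow>\<^sub>L 'a ell2) set \<Rightarrow> bool" where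
  "unital_subalgebra A \<longleftrightarrow>
     A \<subseteq> bounded_ops \<and> id_blinfun \<in> A \<and>
     (\<forall>S\<in>A. \<forall>T\<in>A. S + T \<in> A \<and> S o\<^sub>L T \<in> A) \<and>
     (\<forall>c. \<forall>T\<in>A. scaleC_op c T \<in> A)"

text \<open>The algebraic two-sided ideal of a unital algebra \<open>A\<close> generated by \<open>T\<close>.\<close>

definition two_sided_ideal ::
    "('a ell2 \<Rightarrow>\<^sub>L 'a ell2) set \<Rightarrow> ('a ell2 \<Rightarrow>\<^sub>L 'a ell2) \<Rightarrow> ('a ell2 \<Rightarrow>\<^sub>L 'a ell2) set" where
  "two_sided_ideal A T =
     {\<Sum>i=1..p. B i o\<^sub>L T o\<^sub>L C i | (p::nat) B C. p \<ge> 1 \<and> (\<forall>i\<in>{1..p}. B i \<in> A \<and> C i \<in> A)}"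

section \<open>The non-commutative analytic Toeplitz algebra\<close>

text \<open>The free semigroup on the letters of type \<open>'a\<close> is \<open>'a list\<close> with
  concatenation. The operator \<open>left_creation a\<close> is the isometry sending the basis vector of
  a word \<open>v\<close> to that of \<open>a # v\<close>; see \<open>left_creation_ket\<close> and
  \<open>norm_left_creation\<close> below.\<close>

lift_definition ket :: "'a \<Rightarrow> 'a ell2" is "\<lambda>v w. if w = v then 1 else 0"
  subgoal for v
    by (rule finite_nonzero_values_imp_summable_on, rule finite_subset[of _ "{v}"]) auto
  done

lemma has_sum_shift:
  fixes f :: "'a list \<Rightarrow> complex"
  assumes "(\<lambda>w. (cmod (f w))\<^sup>2) summable_on UNIV"
  shows "((\<lambda>w. (cmod (case w of [] \<Rightarrow> 0 | b # v \<Rightarrow> if b = a then f v else 0))\<^sup>2)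
    has_sum (\<Sum>\<^sub>\<infinity>w. (cmod (f w))\<^sup>2)) UNIV"
proof -
  let ?g = "\<lambda>w. (cmod (case w of [] \<Rightarrow> 0 | b # v \<Rightarrow> if b = a then f v else 0))\<^sup>2"
  have "((\<lambda>w. (cmod (f w))\<^sup>2) has_sum (\<Sum>\<^sub>\<infinity>w. (cmod (f w))\<^sup>2)) UNIV"
    using assms by simp
  then have "(?g \<circ> (#) a has_sum (\<Sum>\<^sub>\<infinity>w. (cmod (f w))\<^sup>2)) UNIV"
    by (simp add: o_def)
  then have "(?g has_sum (\<Sum>\<^sub>\<infinity>w. (cmod (f w))\<^sup>2)) (range ((#) a))"
    by (subst has_sum_reindex) auto
  then show ?thesis
    by (subst has_sum_cong_neutral[of "range ((#) a)" UNIV ?g ?g]) (auto split: list.splits)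
qed

lift_definition shift :: "'a \<Rightarrow> 'a list ell2 \<Rightarrow> 'a list ell2"
  is "\<lambda>a f w. case w of [] \<Rightarrow> 0 | b # v \<Rightarrow> if b = a then f v else 0"
  by (rule has_sum_imp_summable, rule has_sum_shift)

lemma norm_shift: "norm (shift a x) = norm x"
  by transfer (simp add: infsumI[OF has_sum_shift])

lemma bounded_linear_shift: "bounded_linear (shift a)"
proof (rule bounded_linear_intro)
  fix x y :: "'a list ell2" and r :: real
  show "shift a (x + y) = shift a x + shift a y"
    by transfer (auto simp: fun_eq_iff split: list.splits)
  show "shift a (r *\<^sub>R x) = r *\<^sub>R shift a x"
    unfolding scaleR_ell2_def by transfer (auto simp: fun_eq_iff split: list.splits)
  show "norm (shift a x) \<le> norm x * 1"
    by (simp add: norm_shift)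
qed

definition left_creation :: "'a \<Rightarrow> ('a list ell2 \<Rightarrow>\<^sub>L 'a list ell2)" where
  "left_creation a = Blinfun (shift a)"

lemma left_creation_apply: "left_creation a x = shift a x"
  by (simp add: left_creation_def bounded_linear_Blinfun_apply bounded_linear_shift)

lemma left_creation_ket: "left_creation a (ket v) = ket (a # v)"
  unfolding left_creation_apply by transfer (auto simp: fun_eq_iff split: list.splits)

lemma norm_left_creation: "norm (left_creation a x) = norm x"
  by (simp add: left_creation_apply norm_shift)

lemma left_creation_bounded_ops: "left_creation a \<in> bounded_ops"
proof -
  have "shift a (scaleC_ell2 c x) = scaleC_ell2 c (shift a x)" for c and x :: "'a list ell2"
    by transfer (auto simp: fun_eq_iff split: list.splits)
  then show ?thesis
    by (simp add: bounded_ops_def left_creation_apply)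
qed

definition nc_toeplitz_algebra :: "('a list ell2 \<Rightarrow>\<^sub>L 'a list ell2) set" where
  "nc_toeplitz_algebra =
     (\<lambda>A. unital_subalgebra A \<and> closedin weak_operator_topology A) hull range left_creation"

end

theory Submission
  imports Defs
begin

text \<open>
  Let \<open>b\<close> be the letter whose creation operator \<open>L\<^sub>b\<close> generates the ideal, and let \<open>a \<noteq> b\<close> be
  another letter. To an operator \<open>A\<close> attach the infinite matrix whose entry at \<open>(i, j)\<close> is
  the coefficient of \<open>A \<xi>\<^sub>1\<close> at the word \<open>a\<^sup>i b a\<^sup>j\<close>.

  Every element of the algebra acts as convolution with its symbol \<open>A \<xi>\<^sub>1\<close>
  (\<open>nc_toeplitz_algebra_convolution\<close>), so the coefficient of \<open>B L\<^sub>b C \<xi>\<^sub>1\<close> at a word is the sum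
  over all ways of cutting the word as \<open>u b v\<close> of the products of the coefficient of \<open>B\<close> at \<open>u\<close>
  with that of \<open>C\<close> at \<open>v\<close>. The word \<open>a\<^sup>i b a\<^sup>j\<close> contains the letter \<open>b\<close> once and can be cut in one
  way only (\<open>coefficient_single_occurrence\<close>): the matrix of \<open>B L\<^sub>b C\<close> is a product of a column and
  a row. A sum of \<open>p\<close> such operators thus has a matrix of rank at most \<open>p\<close>.

  The operator \<open>\<Sum>\<^sub>k 2\<^sup>-\<^sup>k L\<^sub>a\<^sup>k L\<^sub>b L\<^sub>a\<^sup>k\<close> is a norm limit of elements of the ideal, because
  \<open>L\<^sub>a\<close> and \<open>L\<^sub>b\<close> are isometries, so that the series converges absolutely. Its matrix is
  diagonal with all diagonal entries nonzero, hence of infinite rank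
  (\<open>diagonal_not_finite_rank\<close>), so it does not lie in the ideal (\<open>ideal_not_closed\<close>).
\<close>

section \<open>Coordinates and completeness of the sequence space\<close>

lemma Rep_ell2_0 [simp]: "Rep_ell2 0 w = 0"
  by transfer simp

lemma Rep_ell2_add [simp]: "Rep_ell2 (x + y) w = Rep_ell2 x w + Rep_ell2 y w"
  by transfer simp

lemma Rep_ell2_diff [simp]: "Rep_ell2 (x - y) w = Rep_ell2 x w - Rep_ell2 y w"
  by transfer simp

lemma Rep_ell2_scaleC [simp]: "Rep_ell2 (scaleC_ell2 c x) w = c * Rep_ell2 x w"
  by transfer simp

lemma Rep_ell2_scaleR [simp]: "Rep_ell2 (r *\<^sub>R x) w = r *\<^sub>R Rep_ell2 x w"
  unfolding scaleR_ell2_def by (simp add: scaleR_conv_of_real)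

lemma scaleC_ell2_left_commute:
  "scaleC_ell2 c (scaleC_ell2 d x) = scaleC_ell2 d (scaleC_ell2 c x)"
  by transfer (simp add: mult.left_commute)

lemma Rep_ell2_sum: "Rep_ell2 (\<Sum>i\<in>I. x i) w = (\<Sum>i\<in>I. Rep_ell2 (x i) w)"
  by (induction I rule: infinite_finite_induct) auto

lemma Rep_ell2_ket: "Rep_ell2 (ket v) w = (if w = v then 1 else 0)"
  by transfer simp

lemma Rep_ell2_summable: "(\<lambda>w. (cmod (Rep_ell2 x w))\<^sup>2) summable_on UNIV"
  using Rep_ell2[of x] by simp

lemma norm_ell2_Rep: "norm x = sqrt (\<Sum>\<^sub>\<infinity>w. (cmod (Rep_ell2 x w))\<^sup>2)"
  by transfer simp

lemma sum_Rep_le_norm: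
  assumes "finite F"
  shows "(\<Sum>w\<in>F. (cmod (Rep_ell2 x w))\<^sup>2) \<le> (norm x)\<^sup>2"
proof -
  have "(norm x)\<^sup>2 = (\<Sum>\<^sub>\<infinity>w. (cmod (Rep_ell2 x w))\<^sup>2)"
    unfolding norm_ell2_Rep by (simp add: infsum_nonneg)
  moreover have "(\<Sum>w\<in>F. (cmod (Rep_ell2 x w))\<^sup>2) \<le> (\<Sum>\<^sub>\<infinity>w. (cmod (Rep_ell2 x w))\<^sup>2)"
    by (rule finite_sum_le_infsum[OF Rep_ell2_summable assms]) auto
  ultimately show ?thesis by simp
qed

lemma norm_Rep_le: "norm (Rep_ell2 x w) \<le> norm x"
proof (rule power2_le_imp_le)
  show "(norm (Rep_ell2 x w))\<^sup>2 \<le> (norm x)\<^sup>2"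
    using sum_Rep_le_norm[of "{w}" x] by simp
qed simp

lemma bounded_linear_Rep_ell2: "bounded_linear (\<lambda>x. Rep_ell2 x w)"
  by (rule bounded_linear_intro[where K = 1]) (auto simp: norm_Rep_le)

lemma ell2_of_bounded_sums:
  fixes f :: "'a \<Rightarrow> complex"
  assumes "\<And>F. finite F \<Longrightarrow> (\<Sum>w\<in>F. (cmod (f w))\<^sup>2) \<le> e\<^sup>2" and "e \<ge> 0"
  obtains y where "Rep_ell2 y = f" "norm y \<le> e"
proof -
  have s: "(\<lambda>w. (cmod (f w))\<^sup>2) summable_on UNIV"
    by (rule nonneg_bdd_above_summable_on) (auto intro!: bdd_aboveI2 assms(1))
  then have R: "Rep_ell2 (Abs_ell2 f) = f"
    by (simp add: Abs_ell2_inverse)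
  have "(\<Sum>\<^sub>\<infinity>w. (cmod (f w))\<^sup>2) \<le> e\<^sup>2"
    by (rule infsum_le_finite_sums[OF s]) (auto intro: assms(1))
  then have "norm (Abs_ell2 f) \<le> e"
    unfolding norm_ell2_Rep R using assms(2) real_sqrt_le_mono by fastforce
  with R show thesis by (rule that)
qed

text \<open>Completeness is what provides a limit for an absolutely convergent series of operators.
  A Cauchy sequence converges coordinatewise; letting the second index tend to infinity in the
  Cauchy estimate over a finite set of coordinates bounds all finite square sums of
  \<open>X n - f\<close>, which puts that difference, and with it the pointwise limit \<open>f\<close>, in the space
  and makes the convergence one in norm.\<close>

instance ell2 :: (type) complete_space
proof
  fix X :: "nat \<Rightarrow> 'a ell2"
  assume X: "Cauchy X"
  have "\<exists>f. \<forall>w. (\<lambda>n. Rep_ell2 (X n) w) \<longlonglongrightarrow> f w"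
    using Cauchy_convergent[OF bounded_linear.Cauchy[OF bounded_linear_Rep_ell2 X]]
    unfolding convergent_def by (intro choice allI) blast
  then obtain f where f: "\<And>w. (\<lambda>n. Rep_ell2 (X n) w) \<longlonglongrightarrow> f w" by blast
  have tail: "\<exists>y. Rep_ell2 y = (\<lambda>w. Rep_ell2 (X n) w - f w) \<and> norm y \<le> e"
    if N: "\<And>m. m \<ge> N \<Longrightarrow> norm (X n - X m) \<le> e" for n N e
  proof -
    have e: "e \<ge> 0" using N[of N] norm_ge_zero order_trans by blast
    have "(\<Sum>w\<in>F. (cmod (Rep_ell2 (X n) w - f w))\<^sup>2) \<le> e\<^sup>2" if F: "finite F" for F
    proof (rule tendsto_upperbound)
      show "(\<lambda>m. \<Sum>w\<in>F. (cmod (Rep_ell2 (X n) w - Rep_ell2 (X m) w))\<^sup>2)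
          \<longlonglongrightarrow> (\<Sum>w\<in>F. (cmod (Rep_ell2 (X n) w - f w))\<^sup>2)"
        by (intro tendsto_intros f)
      show "\<forall>\<^sub>F m in sequentially.
          (\<Sum>w\<in>F. (cmod (Rep_ell2 (X n) w - Rep_ell2 (X m) w))\<^sup>2) \<le> e\<^sup>2"
      proof (rule eventually_sequentiallyI)
        fix m assume "m \<ge> N"
        then have "(norm (X n - X m))\<^sup>2 \<le> e\<^sup>2" by (intro power_mono N) auto
        with sum_Rep_le_norm[OF F, of "X n - X m"]
        show "(\<Sum>w\<in>F. (cmod (Rep_ell2 (X n) w - Rep_ell2 (X m) w))\<^sup>2) \<le> e\<^sup>2"
          by simp
      qed
    qed simp
    from ell2_of_bounded_sums[OF this e] show ?thesis by blast
  qed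
  have ev: "\<exists>N. \<forall>n\<ge>N. \<exists>y. Rep_ell2 y = (\<lambda>w. Rep_ell2 (X n) w - f w) \<and> norm y \<le> e"
    if "e > 0" for e
  proof -
    obtain N where "\<forall>m\<ge>N. \<forall>n\<ge>N. norm (X m - X n) < e"
      using CauchyD[OF X \<open>e > 0\<close>] by blast
    then show ?thesis
      by (intro exI[of _ N] allI impI tail[of N]) (auto intro: less_imp_le)
  qed
  obtain n0 y0 where y0: "Rep_ell2 y0 = (\<lambda>w. Rep_ell2 (X n0) w - f w)"
    using ev[of 1] by auto
  define l where "l = X n0 - y0"
  have l: "Rep_ell2 l = f"
    by (simp add: l_def fun_eq_iff y0)
  have "X \<longlonglongrightarrow> l"
  proof (rule LIMSEQ_I)
    fix r :: real assume "r > 0"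
    then obtain N where N: "\<And>n. n \<ge> N \<Longrightarrow>
        \<exists>y. Rep_ell2 y = (\<lambda>w. Rep_ell2 (X n) w - f w) \<and> norm y \<le> r / 2"
      using ev[of "r / 2"] by auto
    have "norm (X n - l) < r" if n: "n \<ge> N" for n
    proof -
      obtain y where "Rep_ell2 y = (\<lambda>w. Rep_ell2 (X n) w - f w)" and y: "norm y \<le> r / 2"
        using N[OF n] by blast
      then have "X n - l = y"
        by (simp add: Rep_ell2_inject[symmetric] fun_eq_iff l)
      with y \<open>r > 0\<close> show ?thesis by simp
    qed
    then show "\<exists>N. \<forall>n\<ge>N. norm (X n - l) < r" by blast
  qed
  then show "convergent X" by (auto simp: convergent_def)
qed

instance ell2 :: (type) banach ..

section \<open>Operators acting by convolution with their symbol\<close>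

text \<open>In the formula \<open>i\<close> ranges over the cuts \<open>w = take i w @ drop i w\<close>, so these are the operators
  of left convolution, over the free semigroup, by the vector \<open>T (ket [])\<close>. Each coordinate of
  the image is a finite sum, which keeps the condition stable under weak limits.\<close>

definition convolution_ops :: "('a list ell2 \<Rightarrow>\<^sub>L 'a list ell2) set" where
  "convolution_ops = {T \<in> bounded_ops. \<forall>x w. Rep_ell2 (T x) w =
     (\<Sum>i\<le>length w. Rep_ell2 (T (ket [])) (take i w) * Rep_ell2 x (drop i w))}"

lemma convolution_opsD:
  "T \<in> convolution_ops \<Longrightarrow> Rep_ell2 (T x) w =
     (\<Sum>i\<le>length w. Rep_ell2 (T (ket [])) (take i w) * Rep_ell2 x (drop i w))"
  unfolding convolution_ops_def by blast

lemma convolution_opsI: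
  assumes "T \<in> bounded_ops" and "\<And>x w. Rep_ell2 (T x) w =
     (\<Sum>i\<le>length w. Rep_ell2 (T (ket [])) (take i w) * Rep_ell2 x (drop i w))"
  shows "T \<in> convolution_ops"
  unfolding convolution_ops_def using assms by blast

text \<open>Both sides are the sum over all factorizations of \<open>w\<close> into three words, of lengths \<open>i\<close>, \<open>j\<close>
  and the remainder; the right-hand side groups them by \<open>k = i + j\<close>.\<close>

lemma convolution_assoc:
  fixes f g h :: "'a list \<Rightarrow> 'b :: comm_semiring_1"
  shows "(\<Sum>i\<le>length w. f (take i w) *
      (\<Sum>j\<le>length (drop i w). g (take j (drop i w)) * h (drop j (drop i w)))) =
    (\<Sum>k\<le>length w. (\<Sum>i\<le>length (take k w). f (take i (take k w)) * g (drop i (take k w)))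
      * h (drop k w))"
proof -
  let ?t = "\<lambda>i j. f (take i w) * g (take j (drop i w)) * h (drop (i + j) w)"
  have "(\<Sum>i\<le>length w. f (take i w) *
      (\<Sum>j\<le>length (drop i w). g (take j (drop i w)) * h (drop j (drop i w)))) =
    (\<Sum>i\<le>length w. \<Sum>j\<le>length w - i. ?t i j)"
    by (simp add: sum_distrib_left mult.assoc add.commute)
  also have "\<dots> = (\<Sum>(i, j)\<in>{(i, j). i + j \<le> length w}. ?t i j)"
    by (subst sum.Sigma) (auto intro!: sum.cong)
  also have "\<dots> = (\<Sum>k\<le>length w. \<Sum>i\<le>k. ?t i (k - i))"
    by (rule sum.triangle_reindex_eq)
  also have "\<dots> = (\<Sum>k\<le>length w. (\<Sum>i\<le>length (take k w).
      f (take i (take k w)) * g (drop i (take k w))) * h (drop k w))"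
    by (intro sum.cong) (auto simp: sum_distrib_right min_def drop_take)
  finally show ?thesis .
qed

lemma cinner_ket: "cinner_ell2 x (ket w) = Rep_ell2 x w"
proof transfer
  fix f :: "'a \<Rightarrow> complex" and w
  show "(\<Sum>\<^sub>\<infinity>v. f v * cnj (if v = w then 1 else 0)) = f w"
    by (subst infsum_cong_neutral[where T = "{w}" and g = f]) auto
qed

lemma continuous_map_WOT_coefficient:
  "continuous_map weak_operator_topology euclidean (\<lambda>T. Rep_ell2 (blinfun_apply T x) w)"
proof -
  have "continuous_map euclidean euclidean
      (\<lambda>\<phi>. \<phi> (x, ket w) :: complex)"
    by (simp add: continuous_on_product_coordinates)
  then have "continuous_map weak_operator_topology euclidean
      ((\<lambda>\<phi>. \<phi> (x, ket w)) \<circ> (\<lambda>T (x, y). cinner_ell2 (blinfun_apply T x) y))"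
    unfolding weak_operator_topology_def by (rule continuous_map_pullback)
  then show ?thesis by (simp add: o_def cinner_ket)
qed

text \<open>For fixed \<open>x\<close> and \<open>w\<close> the convolution formula is an equation between finitely many matrix
  coefficients of \<open>T\<close>, hence defines a closed set of operators.\<close>

lemma closedin_convolution_ops: "closedin weak_operator_topology convolution_ops"
proof -
  define h where "h x w T = Rep_ell2 (blinfun_apply T x) w -
     (\<Sum>i\<le>length w. Rep_ell2 (T (ket [])) (take i w) * Rep_ell2 x (drop i w))"
    for x :: "'a list ell2" and w T
  have "continuous_map weak_operator_topology euclidean
      (\<lambda>T. Rep_ell2 (blinfun_apply T x) w * c)" for x :: "'a list ell2" and w c
    using continuous_map_compose[OF continuous_map_WOT_coefficient[of x w], of euclidean "\<lambda>d. d * c"]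
    by (simp add: o_def continuous_intros)
  then have "continuous_map weak_operator_topology euclidean (h x w)" for x w
    unfolding h_def by (intro continuous_map_diff continuous_map_sum continuous_map_WOT_coefficient) auto
  then have "closedin weak_operator_topology
      {T \<in> topspace weak_operator_topology. h x w T \<in> {0}}" for x w
    by (rule closedin_continuous_map_preimage) auto
  then have "closedin weak_operator_topology
      (\<Inter>(x, w)\<in>UNIV. {T \<in> topspace weak_operator_topology. h x w T \<in> {0}})"
    by (intro closedin_INT) auto
  also have "(\<Inter>(x, w)\<in>UNIV. {T \<in> topspace weak_operator_topology. h x w T \<in> {0}}) =
      convolution_ops"
    by (auto simp: convolution_ops_def h_def topspace_weak_operator_topology)
  finally show ?thesis .
qed

lemma unital_subalgebra_convolution_ops:
  "unital_subalgebra (convolution_ops :: ('a list ell2 \<Rightarrow>\<^sub>L 'a list ell2) set)"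
  unfolding unital_subalgebra_def
proof (intro conjI ballI allI)
  show "convolution_ops \<subseteq> (bounded_ops :: ('a list ell2 \<Rightarrow>\<^sub>L 'a list ell2) set)" by (auto simp: convolution_ops_def)
  \<comment> \<open>The symbol of the identity is the unit for convolution: only the cut at \<open>0\<close> contributes.\<close>
  have "(\<Sum>i\<le>length w. Rep_ell2 (ket []) (take i w) * Rep_ell2 x (drop i w)) = Rep_ell2 x w"
    for x :: "'a list ell2" and w
    by (subst sum.mono_neutral_right[where S = "{0}"]) (auto simp: Rep_ell2_ket)
  then show "(id_blinfun :: 'a list ell2 \<Rightarrow>\<^sub>L 'a list ell2) \<in> convolution_ops"
    by (simp add: convolution_ops_def bounded_ops_def)
next
  fix S T :: "'a list ell2 \<Rightarrow>\<^sub>L 'a list ell2"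
  assume S: "S \<in> convolution_ops" and T: "T \<in> convolution_ops"
  have ops: "S \<in> bounded_ops" "T \<in> bounded_ops"
    using S T by (auto simp: convolution_ops_def)
  have bounded: "S + T \<in> bounded_ops" "S o\<^sub>L T \<in> bounded_ops"
    using ops
    by (auto simp: bounded_ops_def blinfun.add_left linear_simps(1)[OF bounded_linear_scaleC_ell2])
  have add: "Rep_ell2 ((S + T) x) w = (\<Sum>i\<le>length w.
      Rep_ell2 ((S + T) (ket [])) (take i w) * Rep_ell2 x (drop i w))" for x w
    using convolution_opsD[OF S, of x w] convolution_opsD[OF T, of x w]
    by (simp add: blinfun.add_left distrib_right sum.distrib)
  have comp: "Rep_ell2 ((S o\<^sub>L T) x) w = (\<Sum>i\<le>length w.
      Rep_ell2 ((S o\<^sub>L T) (ket [])) (take i w) * Rep_ell2 x (drop i w))" for x w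
  proof -
    let ?s = "Rep_ell2 (S (ket []))" and ?t = "Rep_ell2 (T (ket []))"
    have "Rep_ell2 (S (T x)) w = (\<Sum>i\<le>length w. ?s (take i w) * Rep_ell2 (T x) (drop i w))"
      by (rule convolution_opsD[OF S])
    also have "\<dots> = (\<Sum>i\<le>length w. ?s (take i w) * (\<Sum>j\<le>length (drop i w).
        ?t (take j (drop i w)) * Rep_ell2 x (drop j (drop i w))))"
      by (simp only: convolution_opsD[OF T, of x])
    also have "\<dots> = (\<Sum>k\<le>length w. (\<Sum>i\<le>length (take k w).
        ?s (take i (take k w)) * ?t (drop i (take k w))) * Rep_ell2 x (drop k w))"
      by (rule convolution_assoc)
    also have "\<dots> = (\<Sum>k\<le>length w. Rep_ell2 (S (T (ket []))) (take k w) * Rep_ell2 x (drop k w))"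
      by (simp only: convolution_opsD[OF S, of "T (ket [])"])
    finally show ?thesis by simp
  qed
  show "S + T \<in> convolution_ops"
    by (rule convolution_opsI[OF bounded(1) add])
  show "S o\<^sub>L T \<in> convolution_ops"
    by (rule convolution_opsI[OF bounded(2) comp])
next
  fix c and T :: "'a list ell2 \<Rightarrow>\<^sub>L 'a list ell2"
  assume T: "T \<in> convolution_ops"
  then have "\<forall>d x. T (scaleC_ell2 d x) = scaleC_ell2 d (T x)"
    by (simp add: convolution_ops_def bounded_ops_def)
  then have "scaleC_op c T \<in> bounded_ops"
    by (simp add: bounded_ops_def scaleC_op_apply scaleC_ell2_left_commute)
  moreover have "Rep_ell2 (scaleC_op c T x) w = (\<Sum>i\<le>length w.
      Rep_ell2 (scaleC_op c T (ket [])) (take i w) * Rep_ell2 x (drop i w))" for x w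
    using convolution_opsD[OF T, of x w]
    by (simp add: scaleC_op_apply sum_distrib_left mult.assoc)
  ultimately show "scaleC_op c T \<in> convolution_ops"
    by (rule convolution_opsI)
qed

lemma Rep_ell2_left_creation:
  "Rep_ell2 (left_creation a x) w = (case w of [] \<Rightarrow> 0 | b # v \<Rightarrow> if b = a then Rep_ell2 x v else 0)"
  unfolding left_creation_apply by transfer simp

lemma left_creation_convolution_ops: "left_creation a \<in> convolution_ops"
proof -
  have "(\<Sum>i\<le>length w. Rep_ell2 (left_creation a (ket [])) (take i w) * Rep_ell2 x (drop i w)) =
      Rep_ell2 (left_creation a x) w" for x w
  proof (cases w)
    case Nil
    then show ?thesis by (simp add: Rep_ell2_left_creation)
  next
    case (Cons b v)
    then have "(\<Sum>i\<le>length w. Rep_ell2 (left_creation a (ket [])) (take i w) * Rep_ell2 x (drop i w))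
      = (\<Sum>i\<in>{1}. Rep_ell2 (left_creation a (ket [])) (take i w) * Rep_ell2 x (drop i w))"
      by (intro sum.mono_neutral_right)
        (auto simp: left_creation_ket Rep_ell2_ket take_Cons split: nat.splits)
    with Cons show ?thesis
      by (simp add: Rep_ell2_left_creation left_creation_ket Rep_ell2_ket)
  qed
  then show ?thesis by (simp add: convolution_ops_def left_creation_bounded_ops)
qed

text \<open>The algebra is the least weakly closed unital algebra containing the left creation operators,
  and the convolution operators form such an algebra.\<close>

lemma nc_toeplitz_algebra_convolution: "nc_toeplitz_algebra \<subseteq> convolution_ops"
  unfolding nc_toeplitz_algebra_def
  by (rule hull_minimal) (auto simp: left_creation_convolution_ops
      unital_subalgebra_convolution_ops closedin_convolution_ops)

section \<open>Products of left creation operators\<close>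

fun word_op :: "'a list \<Rightarrow> ('a list ell2 \<Rightarrow>\<^sub>L 'a list ell2)" where
  "word_op [] = id_blinfun"
| "word_op (a # w) = left_creation a o\<^sub>L word_op w"

lemma word_op_ket: "word_op u (ket v) = ket (u @ v)"
  by (induction u) (auto simp: left_creation_ket)

lemma norm_word_op_apply: "norm (word_op u x) = norm x"
  by (induction u) (auto simp: norm_left_creation)

lemma norm_word_op_le: "norm (word_op u) \<le> 1"
  by (rule norm_blinfun_bound) (auto simp: norm_word_op_apply)

lemma word_op_append: "word_op (u @ v) = word_op u o\<^sub>L word_op v"
  by (induction u) (auto intro: blinfun_eqI)

lemma scaleR_word_op_in: "r *\<^sub>R word_op w \<in> nc_toeplitz_algebra"
  unfolding nc_toeplitz_algebra_def hull_def
proof clarsimp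
  fix A :: "('a list ell2 \<Rightarrow>\<^sub>L 'a list ell2) set"
  assume A: "unital_subalgebra A" and L: "range left_creation \<subseteq> A"
  have "word_op w \<in> A"
    using A L by (induction w) (auto simp: unital_subalgebra_def)
  then have "scaleC_op (of_real r) (word_op w) \<in> A"
    using A by (auto simp: unital_subalgebra_def)
  moreover have "scaleC_op (of_real r) (word_op w) = r *\<^sub>R word_op w"
    by (rule blinfun_eqI) (simp add: scaleC_op_apply scaleR_ell2_def blinfun.scaleR_left)
  ultimately show "r *\<^sub>R word_op w \<in> A" by simp
qed

section \<open>Coefficients at words with one occurrence of the generator\<close>

text \<open>A cut of the word \<open>u b v\<close> contributes to the convolution only if its right part starts
  with \<open>b\<close>, the image of \<open>left_creation b\<close> being supported on such words; as \<open>b\<close> occurs only once,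
  this is the cut right after \<open>u\<close>.\<close>

lemma coefficient_single_occurrence:
  assumes B: "B \<in> convolution_ops" and b: "b \<notin> set u" "b \<notin> set v"
  shows "Rep_ell2 ((B o\<^sub>L left_creation b o\<^sub>L C) (ket [])) (u @ b # v) =
    Rep_ell2 (B (ket [])) u * Rep_ell2 (C (ket [])) v"
proof -
  let ?w = "u @ b # v"
  let ?t = "\<lambda>k. Rep_ell2 (B (ket [])) (take k ?w) *
    Rep_ell2 (left_creation b (C (ket []))) (drop k ?w)"
  have "?t k = 0" if "k \<noteq> length u" for k
  proof (cases "drop k ?w")
    case (Cons c r)
    then have "k < length ?w" and "c = ?w ! k"
      by (metis drop_all leI list.discI, metis nth_via_drop)
    then have "c \<in> set u \<union> set v"
      using that by (auto simp: nth_append nth_Cons split: nat.splits if_splits)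
    then show ?thesis using b Cons by (auto simp: Rep_ell2_left_creation)
  qed (simp add: Rep_ell2_left_creation)
  then have "(\<Sum>k\<le>length ?w. ?t k) = (\<Sum>k\<in>{length u}. ?t k)"
    by (intro sum.mono_neutral_right) auto
  then show ?thesis
    using convolution_opsD[OF B, of "left_creation b (C (ket []))" ?w]
    by (simp add: Rep_ell2_left_creation)
qed

section \<open>Diagonal matrices of infinite rank\<close>

text \<open>Gaussian elimination: if the equation \<open>l0\<close> involves the unknown \<open>j\<close>, solve it for that unknown
  and substitute into the others, which leaves one equation and one unknown less.\<close>

lemma homogeneous_system_nontrivial_solution:
  fixes m :: "'l \<Rightarrow> 'i \<Rightarrow> 'b :: field"
  assumes "finite L" "finite I" "card L < card I"
  shows "\<exists>\<alpha>. (\<exists>i\<in>I. \<alpha> i \<noteq> 0) \<and> (\<forall>l\<in>L. (\<Sum>i\<in>I. \<alpha> i * m l i) = 0)"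
  using assms
proof (induction L arbitrary: I m rule: finite_induct)
  case empty
  then have "I \<noteq> {}" by auto
  then show ?case by (intro exI[of _ "\<lambda>_. 1"]) auto
next
  case (insert l0 L)
  show ?case
  proof (cases "\<forall>i\<in>I. m l0 i = 0")
    case True
    obtain \<alpha> where "\<exists>i\<in>I. \<alpha> i \<noteq> 0" "\<forall>l\<in>L. (\<Sum>i\<in>I. \<alpha> i * m l i) = 0"
      using insert.IH[of I m] insert.prems insert.hyps by auto
    with True show ?thesis by (intro exI[of _ \<alpha>]) auto
  next
    case False
    then obtain j where j: "j \<in> I" "m l0 j \<noteq> 0" by blast
    define J where "J = I - {j}"
    have J: "finite J" "I = insert j J" "j \<notin> J" "card L < card J"
      using insert.prems insert.hyps j by (auto simp: J_def)
    obtain \<beta> where \<beta>: "\<exists>i\<in>J. \<beta> i \<noteq> 0"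
      "\<forall>l\<in>L. (\<Sum>i\<in>J. \<beta> i * (m l i - m l j * m l0 i / m l0 j)) = 0"
      using insert.IH[of J "\<lambda>l i. m l i - m l j * m l0 i / m l0 j"] J by auto
    \<comment> \<open>The value of the eliminated unknown is dictated by the equation \<open>l0\<close>.\<close>
    define s where "s = (\<Sum>i\<in>J. \<beta> i * m l0 i) / m l0 j"
    define \<alpha> where "\<alpha> = \<beta>(j := - s)"
    have sum: "(\<Sum>i\<in>I. \<alpha> i * m l i) = (\<Sum>i\<in>J. \<beta> i * m l i) - s * m l j" for l
    proof -
      have "(\<Sum>i\<in>J. \<alpha> i * m l i) = (\<Sum>i\<in>J. \<beta> i * m l i)"
        using J(3) by (intro sum.cong) (auto simp: \<alpha>_def)
      then show ?thesis using J by (simp add: \<alpha>_def)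
    qed
    have "(\<Sum>i\<in>I. \<alpha> i * m l0 i) = 0"
      unfolding sum using j by (simp add: s_def)
    moreover have "(\<Sum>i\<in>I. \<alpha> i * m l i) = 0" if "l \<in> L" for l
    proof -
      have "(\<Sum>i\<in>J. \<beta> i * (m l i - m l j * m l0 i / m l0 j)) =
          (\<Sum>i\<in>J. \<beta> i * m l i) - s * m l j"
        by (simp add: s_def right_diff_distrib sum_subtractf sum_divide_distrib
            sum_distrib_left sum_distrib_right mult_ac)
      with \<beta>(2) that show ?thesis by (simp add: sum)
    qed
    moreover have "\<exists>i\<in>I. \<alpha> i \<noteq> 0" using \<beta>(1) J by (auto simp: \<alpha>_def)
    ultimately show ?thesis by blast
  qed
qed

text \<open>Among the first \<open>p + 1\<close> rows of a sum of \<open>p\<close> products of a column and a row there is a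
  nontrivial linear relation \<open>\<alpha>\<close>, found by annihilating the \<open>p\<close> columns. In a diagonal matrix
  the relation reads \<open>\<alpha> j * d j = 0\<close> for each \<open>j\<close>.\<close>

lemma diagonal_not_finite_rank:
  fixes f g :: "nat \<Rightarrow> nat \<Rightarrow> 'b :: field"
  assumes "\<And>i. d i \<noteq> 0"
    and eq: "\<And>i j. (\<Sum>l=1..p. f l i * g l j) = (if i = j then d i else 0)"
  shows False
proof -
  obtain \<alpha> j where j: "j \<le> p" "\<alpha> j \<noteq> 0"
    and \<alpha>: "\<forall>l\<in>{1..p}. (\<Sum>i\<le>p. \<alpha> i * f l i) = 0"
    using homogeneous_system_nontrivial_solution[of "{1..p}" "{..p}" f] by auto
  have "\<alpha> j * d j = (\<Sum>i\<le>p. \<alpha> i * (if i = j then d i else 0))"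
    using j by (simp add: if_distrib cong: if_cong)
  also have "\<dots> = (\<Sum>i\<le>p. \<Sum>l=1..p. \<alpha> i * f l i * g l j)"
    by (simp add: eq[symmetric] sum_distrib_left mult.assoc)
  also have "\<dots> = (\<Sum>l=1..p. (\<Sum>i\<le>p. \<alpha> i * f l i) * g l j)"
    by (subst sum.swap) (simp add: sum_distrib_right)
  also have "\<dots> = 0" using \<alpha> by simp
  finally show False using j assms(1)[of j] by simp
qed

section \<open>The ideal is not closed\<close>

theorem ideal_not_closed:
  fixes a b :: 'a
  assumes ab: "a \<noteq> b"
  shows "\<not> closed (two_sided_ideal nc_toeplitz_algebra (left_creation b))"
proof
  let ?I = "two_sided_ideal nc_toeplitz_algebra (left_creation b)"
  assume closed: "closed ?I"
  define w where "w i j = replicate i a @ b # replicate j a" for i j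
  define t where "t k = (1 / 2 :: real) ^ k *\<^sub>R word_op (w k k)" for k
  have "norm (t k) \<le> (1 / 2) ^ k" for k
    using norm_word_op_le[of "w k k"] by (simp add: t_def mult_left_le)
  then have "summable t"
    by (intro summable_comparison_test'[OF summable_geometric[of "1 / 2 :: real"]]) auto
  then have T: "t sums suminf t" by (rule summable_sums)

  have in_ideal: "(\<Sum>k<Suc p. t k) \<in> ?I" for p
  proof -
    \<comment> \<open>The ideal numbers its summands from 1, the series from 0.\<close>
    let ?B = "\<lambda>i. (1 / 2 :: real) ^ (i - 1) *\<^sub>R word_op (replicate (i - 1) a)"
    let ?C = "\<lambda>i. word_op (replicate (i - 1) a)"
    have summand: "?B (Suc k) o\<^sub>L left_creation b o\<^sub>L ?C (Suc k) = t k" for k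
      by (rule blinfun_eqI)
        (simp add: t_def w_def word_op_append blinfun.scaleR_left)
    have "(\<Sum>i=1..Suc p. f i) = (\<Sum>k<Suc p. f (Suc k))"
      for f :: "nat \<Rightarrow> 'a list ell2 \<Rightarrow>\<^sub>L 'a list ell2"
      by (simp only: One_nat_def sum.atLeast1_atMost_eq)
    then have "(\<Sum>i=1..Suc p. ?B i o\<^sub>L left_creation b o\<^sub>L ?C i) = (\<Sum>k<Suc p. t k)"
      by (simp only: summand)
    moreover have "?B i \<in> nc_toeplitz_algebra" "?C i \<in> nc_toeplitz_algebra" for i
      using scaleR_word_op_in scaleR_word_op_in[of 1] by auto
    ultimately show ?thesis
      unfolding two_sided_ideal_def
      by (intro CollectI exI[of _ "Suc p"] exI[of _ ?B] exI[of _ ?C] conjI ballI)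
        (simp_all only: le_add1 Suc_eq_plus1_left)
  qed
  have lim: "(\<lambda>p. \<Sum>k<Suc p. t k) \<longlonglongrightarrow> suminf t"
    using T unfolding sums_def by (rule LIMSEQ_Suc)
  have "suminf t \<in> ?I"
    by (rule closed_sequentially[OF closed in_ideal lim])
  then obtain p :: nat and B C where BC: "suminf t = (\<Sum>l=1..p. B l o\<^sub>L left_creation b o\<^sub>L C l)"
    and B: "\<forall>l\<in>{1..p}. B l \<in> nc_toeplitz_algebra \<and> C l \<in> nc_toeplitz_algebra"
    unfolding two_sided_ideal_def by blast

  \<comment> \<open>The first run of letters before \<open>b\<close> recovers \<open>i\<close>, which makes the matrix of the limit diagonal.\<close>
  have w_inj: "w i j = w k k \<longleftrightarrow> i = k \<and> j = k" for i j k
  proof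
    assume eq: "w i j = w k k"
    have "takeWhile (\<lambda>c. c \<noteq> b) (w i j) = replicate i a" for i j
      using ab by (simp add: w_def takeWhile_append)
    then have "i = k" using eq by (metis length_replicate)
    with eq show "i = k \<and> j = k" by (simp add: w_def)
  qed simp
  have "Rep_ell2 (suminf t (ket [])) (w i j) = (if i = j then (1 / 2) ^ i else 0)" for i j
  proof -
    have bl: "bounded_linear (\<lambda>S :: 'a list ell2 \<Rightarrow>\<^sub>L 'a list ell2. Rep_ell2 (S (ket [])) (w i j))"
      by (rule bounded_linear_compose[OF bounded_linear_Rep_ell2 blinfun.bounded_linear_left])
    have "Rep_ell2 (t k (ket [])) (w i j) = (if k = i then if i = j then (1 / 2) ^ i else 0 else 0)"
      for k
      by (auto simp: t_def blinfun.scaleR_left word_op_ket Rep_ell2_ket w_inj scaleR_conv_of_real)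
    with bounded_linear.sums[OF bl T]
    have "(\<lambda>k. if k = i then if i = j then (1 / 2) ^ i else 0 else 0) sums
        Rep_ell2 (suminf t (ket [])) (w i j)"
      by simp
    from sums_unique2[OF this sums_single] show ?thesis .
  qed
  moreover have "Rep_ell2 (suminf t (ket [])) (w i j) =
      (\<Sum>l=1..p. Rep_ell2 (B l (ket [])) (replicate i a) * Rep_ell2 (C l (ket [])) (replicate j a))"
    for i j
  proof -
    have "B l \<in> convolution_ops" if "l \<in> {1..p}" for l
      using B that nc_toeplitz_algebra_convolution by blast
    then show ?thesis
      unfolding BC w_def blinfun.sum_left Rep_ell2_sum using ab
      by (intro sum.cong coefficient_single_occurrence) auto
  qed
  ultimately show False
    by (intro diagonal_not_finite_rank[where p = p and d = "\<lambda>i. (1 / 2 :: complex) ^ i"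
        and f = "\<lambda>l i. Rep_ell2 (B l (ket [])) (replicate i a)"
        and g = "\<lambda>l j. Rep_ell2 (C l (ket [])) (replicate j a)"]) simp_all
qed

theorem theorem3p4:
  fixes n :: nat and z :: "nat \<Rightarrow> 'a"
  assumes "n \<ge> 2" and "bij_betw z {1..n} (UNIV :: 'a set)"
  shows "\<not> closed (two_sided_ideal nc_toeplitz_algebra (left_creation (z 2)))"
proof (rule ideal_not_closed)
  have "inj_on z {1..n}" using assms(2) by (rule bij_betw_imp_inj_on)
  from inj_on_eq_iff[OF this, of 1 2] show "z 1 \<noteq> z 2"
    using assms(1) by simp
qed

end
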